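(* Let $K$ be a real number field, with ring of integers $\mathfrak{O}_K$, and let $\mathfrak{O}_K^+=\mathfrak{O}_K\cap[0,\infty)$. Then for every finite collection of distinct nonzero elements $\alpha_1,\dots,\alpha_n\in\mathfrak{O}_K^+$ that generate $\mathfrak{O}_K$ as a $\mathbb{Z}$-module, there exists $w\in\mathrm{SG}(\alpha_1,\dots,\alpha_n)$ such that $$w+\big(C_\mathbb{Q}(\alpha_1,\dots,\alpha_n)\cap\mathfrak{O}_K\big)\subseteq\mathrm{SG}(\alpha_1,\dots,\alpha_n).$$ Equivalently, $\mathrm{Frob}(\alpha_1,\dots,\alpha_n)\neq\emptyset$ for all such collections (i.e. the Frobenius template $(\mathfrak{O}_K^+,\mathbb{N},C_\mathbb{Q}\cap\mathfrak{O}_K)$ is Frobenius).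
   Context: A real number field is a number field (finite extension of $\mathbb{Q}$) that is a subfield of $\mathbb{R}$. $\mathbb{N}=\{0,1,2,\dots\}$. For $\alpha_1,\dots,\alpha_n\in\mathfrak{O}_K^+$, define $\mathrm{SG}(\alpha_1,\dots,\alpha_n)=\{\sum_{i=1}^n x_i\alpha_i \mid x_1,\dots,x_n\in\mathbb{N}\}$, $C_\mathbb{Q}(\alpha_1,\dots,\alpha_n)=\{\sum_{i=1}^n x_i\alpha_i\mid x_1,\dots,x_n\in\mathbb{Q}_{\geqslant 0}\}$, and $\mathrm{Frob}(\alpha_1,\dots,\alpha_n)=\{w\in\mathrm{SG}(\alpha_1,\dots,\alpha_n)\mid w+(C_\mathbb{Q}(\alpha_1,\dots,\alpha_n)\cap\mathfrak{O}_K)\subseteq\mathrm{SG}(\alpha_1,\dots,\alpha_n)\}$. *)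

theory Defs
  imports Complex_Main "HOL-Computational_Algebra.Computational_Algebra"
begin

definition rat_scale :: "rat \<Rightarrow> real \<Rightarrow> real" where
  "rat_scale q x = of_rat q * x"

definition int_scale :: "int \<Rightarrow> real \<Rightarrow> real" where
  "int_scale k x = of_int k * x"

lemma vector_space_rat_scale: "vector_space rat_scale"
  by unfold_locales (simp_all add: rat_scale_def algebra_simps of_rat_add of_rat_mult)

lemma module_int_scale: "module int_scale"
  by unfold_locales (simp_all add: int_scale_def algebra_simps)

definition real_number_field :: "real set \<Rightarrow> bool" where
  "real_number_field K \<longleftrightarrow>
     0 \<in> K \<and> 1 \<in> K \<and>
     (\<forall>x\<in>K. \<forall>y\<in>K. x + y \<in> K) \<and> (\<forall>x\<in>K. - x \<in> K) \<and>
     (\<forall>x\<in>K. \<forall>y\<in>K. x * y \<in> K) \<and> (\<forall>x\<in>K. x \<noteq> 0 \<longrightarrow> inverse x \<in> K) \<and>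
     (\<exists>B. finite B \<and> module.span rat_scale B = K)"

definition ring_of_integers :: "real set \<Rightarrow> real set" where
  "ring_of_integers K = {x \<in> K. algebraic_int x}"

definition nonneg_integers :: "real set \<Rightarrow> real set" where
  "nonneg_integers K = ring_of_integers K \<inter> {0..}"

text \<open>A collection of \<open>n\<close> elements is a function restricted to the indices \<open>1, \<dots>, n\<close>.\<close>

definition SG :: "nat \<Rightarrow> (nat \<Rightarrow> real) \<Rightarrow> real set" where
  "SG n \<alpha> = {\<Sum>i=1..n. of_nat (x i) * \<alpha> i | x :: nat \<Rightarrow> nat. True}"

definition CQ :: "nat \<Rightarrow> (nat \<Rightarrow> real) \<Rightarrow> real set" where
  "CQ n \<alpha> = {\<Sum>i=1..n. of_rat (x i) * \<alpha> i | x :: nat \<Rightarrow> rat. \<forall>i\<in>{1..n}. 0 \<le> x i}"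

definition Frob :: "real set \<Rightarrow> nat \<Rightarrow> (nat \<Rightarrow> real) \<Rightarrow> real set" where
  "Frob K n \<alpha> =
     {w \<in> SG n \<alpha>. (\<lambda>v. w + v) ` (CQ n \<alpha> \<inter> ring_of_integers K) \<subseteq> SG n \<alpha>}"

end

(* Write v in C_Q as its integer part (floors of the rational coefficients) plus a remainder in the
   half-open box {sum r_i alpha_i | 0 <= r_i < 1}.  The remainder again lies in the lattice O_K, and
   a lattice has only finitely many points in such a box: with respect to a rational basis all
   coordinates are bounded and have a common denominator.  Choose an integer representation of each
   of these finitely many points; if M bounds all coefficients that occur, then
   w = M (alpha_1 + ... + alpha_n) makes the coefficients of w + v nonnegative. *)
theory Submission imports Defs begin

interpretation Q: vector_space rat_scale
  by (rule vector_space_rat_scale)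

interpretation Z: module int_scale
  by (rule module_int_scale)

text \<open>Adjoining one fraction multiplies the denominator found so far by that of the new
  fraction.\<close>

lemma common_denominator:
  fixes S :: "rat set"
  assumes "finite S"
  shows "\<exists>d::int. d > 0 \<and> (\<forall>q\<in>S. of_int d * q \<in> \<int>)"
  using assms
proof (induction S rule: finite_induct)
  case empty
  show ?case by (rule exI[of _ 1]) simp
next
  case (insert p S)
  then obtain d where d: "d > 0" "\<forall>q\<in>S. of_int d * q \<in> \<int>" by blast
  obtain a b where p: "p = of_int a / of_int b" and b: "b > 0"
    by (metis Fract_of_int_quotient Rat_cases)
  have "of_int (d * b) * p = of_int (d * a)"
    using p b by simp
  then have "of_int (d * b) * p \<in> \<int>"
    by (metis Ints_of_int)
  moreover have "of_int (d * b) * q \<in> \<int>" if "q \<in> S" for q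
  proof -
    have "of_int b * (of_int d * q) \<in> \<int>"
      using Ints_mult[OF Ints_of_int bspec[OF d(2) that]] .
    then show ?thesis by (simp add: mult_ac)
  qed
  ultimately show ?case
    using d(1) b by (intro exI[of _ "d * b"]) auto
qed

text \<open>Rationality of \<open>r\<close> is essential: for the generators 1 and sqrt 2 the
  integer combinations are dense in the reals, so a box with real coefficients would contain
  infinitely many. The \<open>a i\<close> may be dependent over the rationals, so coefficients are
  not functions of the point; coordinates in a basis \<open>B\<close> are.\<close>

lemma finite_lattice_points_in_box:
  fixes a :: "'i \<Rightarrow> real"
  assumes fin: "finite I"
  shows "finite {x. (\<exists>z :: 'i \<Rightarrow> int. x = (\<Sum>i\<in>I. of_int (z i) * a i)) \<and>
    (\<exists>r :: 'i \<Rightarrow> rat. (\<forall>i\<in>I. 0 \<le> r i \<and> r i < 1) \<and> x = (\<Sum>i\<in>I. of_rat (r i) * a i))}"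
    (is "finite ?R")
proof -
  obtain B where B: "B \<subseteq> a ` I" "Q.independent B" "a ` I \<subseteq> Q.span B"
    using Q.maximal_independent_subset[of "a ` I"] by blast
  have finB: "finite B" using B(1) fin finite_subset by blast
  define c where "c = (\<lambda>i. Q.representation B (a i))"
  \<comment> \<open>Coordinates are linear over the rationals. This is applied twice: to integer
    coefficients for \<open>int\<close>, and to coefficients in [0, 1) for
    \<open>bound\<close>.\<close>
  have rep: "Q.representation B (\<Sum>i\<in>I. of_rat (q i) * a i) b = (\<Sum>i\<in>I. q i * c i b)" for q b
  proof -
    have "Q.representation B (\<Sum>i\<in>I. rat_scale (q i) (a i)) b =
        (\<Sum>i\<in>I. Q.representation B (rat_scale (q i) (a i)) b)"
      using B by (subst Q.representation_sum) (auto intro: Q.span_scale)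
    also have "\<dots> = (\<Sum>i\<in>I. q i * c i b)"
      unfolding c_def using B by (intro sum.cong refl) (subst Q.representation_scale, auto)
    finally show ?thesis by (simp add: rat_scale_def)
  qed
  \<comment> \<open>Only the finitely many coordinates of the generators need a common denominator;
    it then serves all their integer combinations.\<close>
  have "finite ((\<lambda>(i, b). c i b) ` (I \<times> B))" using fin finB by simp
  from common_denominator[OF this] obtain d :: int
    where d: "d > 0" "\<And>i b. i \<in> I \<Longrightarrow> b \<in> B \<Longrightarrow> of_int d * c i b \<in> \<int>"
    by auto
  define N where "N = (\<lambda>b. \<Sum>i\<in>I. \<bar>c i b\<bar>)"
  \<comment> \<open>On \<open>?R\<close> the floor loses nothing, because the scaled coordinates are
    already integers; it only changes the type. \<open>restrict\<close> makes the values
    extensional, so that they lie in a finite \<open>PiE\<close> set.\<close>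
  define coord where
    "coord = (\<lambda>x. restrict (\<lambda>b. \<lfloor>of_int d * Q.representation B x b\<rfloor>) B)"
  have int: "of_int d * Q.representation B x b \<in> \<int>" if x: "x \<in> ?R" and b: "b \<in> B" for x b
  proof -
    from x obtain z :: "'i \<Rightarrow> int" where "x = (\<Sum>i\<in>I. of_rat (of_int (z i)) * a i)" by auto
    then have "Q.representation B x b = (\<Sum>i\<in>I. of_int (z i) * c i b)"
      by (simp only: rep)
    then have "of_int d * Q.representation B x b = (\<Sum>i\<in>I. of_int (z i) * (of_int d * c i b))"
      by (simp only: sum_distrib_left) (intro sum.cong refl mult.left_commute)
    moreover have "\<dots> \<in> \<int>"
      by (rule Ints_sum) (rule Ints_mult[OF Ints_of_int d(2)[OF _ b]])
    ultimately show ?thesis by (simp only:)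
  qed
  have bound: "\<bar>Q.representation B x b\<bar> \<le> N b" if x: "x \<in> ?R" for x b
  proof -
    from x obtain r :: "'i \<Rightarrow> rat" where r: "\<forall>i\<in>I. 0 \<le> r i \<and> r i < 1"
      and "x = (\<Sum>i\<in>I. of_rat (r i) * a i)" by auto
    then have "\<bar>Q.representation B x b\<bar> = \<bar>\<Sum>i\<in>I. r i * c i b\<bar>" by (simp only: rep)
    also have "\<dots> \<le> (\<Sum>i\<in>I. \<bar>r i * c i b\<bar>)" by (rule sum_abs)
    also have "\<dots> \<le> N b"
      unfolding N_def abs_mult using r by (intro sum_mono mult_left_le_one_le) auto
    finally show ?thesis .
  qed
  have inspan: "x \<in> Q.span B" if "x \<in> ?R" for x
  proof -
    from that obtain r :: "'i \<Rightarrow> rat" where "x = (\<Sum>i\<in>I. rat_scale (r i) (a i))"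
      by (auto simp: rat_scale_def)
    then show ?thesis using B(3) by (auto intro!: Q.span_sum Q.span_scale)
  qed
  have "inj_on coord ?R"
  proof (rule inj_onI)
    fix x y assume x: "x \<in> ?R" and y: "y \<in> ?R" and eq: "coord x = coord y"
    have "Q.representation B x b = Q.representation B y b" if b: "b \<in> B" for b
    proof -
      have "\<lfloor>of_int d * Q.representation B x b\<rfloor> = \<lfloor>of_int d * Q.representation B y b\<rfloor>"
        using fun_cong[OF eq, of b] b by (simp add: coord_def)
      then have "of_int d * Q.representation B x b = of_int d * Q.representation B y b"
        using int[OF x b] int[OF y b] by (elim Ints_cases) (simp only: floor_of_int)
      then show ?thesis using d(1) by simp
    qed
    then have "(\<Sum>b\<in>B. rat_scale (Q.representation B x b) b) =
        (\<Sum>b\<in>B. rat_scale (Q.representation B y b) b)" by simp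
    then show "x = y"
      using Q.sum_representation_eq[OF B(2) inspan[OF x] finB]
        Q.sum_representation_eq[OF B(2) inspan[OF y] finB] by simp
  qed
  moreover have "coord ` ?R \<subseteq> (\<Pi>\<^sub>E b\<in>B. {\<lfloor>- (of_int d * N b)\<rfloor>..\<lfloor>of_int d * N b\<rfloor>})"
  proof (rule image_subsetI)
    fix x assume x: "x \<in> ?R"
    have "\<bar>of_int d * Q.representation B x b\<bar> \<le> of_int d * N b" for b
      using mult_left_mono[OF bound[OF x, of b], of "of_int d"] d(1) by (simp add: abs_mult)
    then have "- (of_int d * N b) \<le> of_int d * Q.representation B x b"
      and "of_int d * Q.representation B x b \<le> of_int d * N b" for b
      by (simp_all only: abs_le_iff minus_le_iff)
    from floor_mono[OF this(1)] floor_mono[OF this(2)]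
    show "coord x \<in> (\<Pi>\<^sub>E b\<in>B. {\<lfloor>- (of_int d * N b)\<rfloor>..\<lfloor>of_int d * N b\<rfloor>})"
      unfolding coord_def restrict_PiE_iff atLeastAtMost_iff by blast
  qed
  moreover have "finite (\<Pi>\<^sub>E b\<in>B. {\<lfloor>- (of_int d * N b)\<rfloor>..\<lfloor>of_int d * N b\<rfloor>})"
    using finB by (intro finite_PiE) auto
  ultimately show ?thesis
    by (rule inj_on_finite)
qed

text \<open>The span has coefficients indexed by the generators themselves; injectivity of
  \<open>a\<close> lets them be indexed by \<open>I\<close> instead, through
  \<open>the_inv_into\<close>.\<close>

lemma span_int_scale_image:
  assumes "finite I" "inj_on a I"
  shows "Z.span (a ` I) = {\<Sum>i\<in>I. of_int (z i) * a i | z. True}"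
proof -
  have "Z.span (a ` I) = range (\<lambda>u. \<Sum>i\<in>I. of_int (u (a i)) * a i)"
    using assms by (simp add: Z.span_finite sum.reindex int_scale_def)
  also have "\<dots> = {\<Sum>i\<in>I. of_int (z i) * a i | z. True}"
  proof safe
    fix z :: "'a \<Rightarrow> int"
    have "(\<Sum>i\<in>I. of_int (z i) * a i) = (\<Sum>i\<in>I. of_int ((z \<circ> the_inv_into I a) (a i)) * a i)"
      using assms(2) by (intro sum.cong) (auto simp: the_inv_into_f_f)
    then show "(\<Sum>i\<in>I. of_int (z i) * a i) \<in> range (\<lambda>u. \<Sum>i\<in>I. of_int (u (a i)) * a i)"
      by blast
  qed auto
  finally show ?thesis .
qed

text \<open>One \<open>m\<close> must serve all \<open>z\<close> and \<open>q\<close>. This is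
  possible because negative coefficients can come only from the remainder, which ranges over a
  finite set.\<close>

lemma exists_Frobenius_shift:
  fixes a :: "'i \<Rightarrow> real"
  assumes fin: "finite I"
  shows "\<exists>m::nat. \<forall>(z :: 'i \<Rightarrow> int) q :: 'i \<Rightarrow> rat.
    (\<forall>i\<in>I. 0 \<le> q i) \<longrightarrow> (\<Sum>i\<in>I. of_int (z i) * a i) = (\<Sum>i\<in>I. of_rat (q i) * a i) \<longrightarrow>
    (\<exists>x :: 'i \<Rightarrow> nat. (\<Sum>i\<in>I. of_nat m * a i) + (\<Sum>i\<in>I. of_rat (q i) * a i) =
      (\<Sum>i\<in>I. of_nat (x i) * a i))"
proof -
  define R where "R = {x. (\<exists>z :: 'i \<Rightarrow> int. x = (\<Sum>i\<in>I. of_int (z i) * a i)) \<and>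
    (\<exists>r :: 'i \<Rightarrow> rat. (\<forall>i\<in>I. 0 \<le> r i \<and> r i < 1) \<and> x = (\<Sum>i\<in>I. of_rat (r i) * a i))}"
  have finR: "finite R"
    unfolding R_def by (rule finite_lattice_points_in_box[OF fin])
  have "\<forall>x\<in>R. \<exists>z :: 'i \<Rightarrow> int. x = (\<Sum>i\<in>I. of_int (z i) * a i)"
    by (auto simp: R_def)
  then obtain \<zeta> :: "real \<Rightarrow> 'i \<Rightarrow> int"
    where \<zeta>: "\<And>x. x \<in> R \<Longrightarrow> x = (\<Sum>i\<in>I. of_int (\<zeta> x i) * a i)"
    by metis
  \<comment> \<open>A sum of absolute values dominates each of its terms and, unlike a maximum, is
    harmless when the index set is empty.\<close>
  define m where "m = (\<Sum>x\<in>R. \<Sum>i\<in>I. nat \<bar>\<zeta> x i\<bar>)"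
  have m: "- \<zeta> x i \<le> int m" if "x \<in> R" "i \<in> I" for x i
  proof -
    have "nat \<bar>\<zeta> x i\<bar> \<le> (\<Sum>i\<in>I. nat \<bar>\<zeta> x i\<bar>)"
      using fin that by (intro member_le_sum) auto
    also have "\<dots> \<le> m"
      unfolding m_def using finR that by (intro member_le_sum[of x R]) auto
    finally show ?thesis by linarith
  qed
  show ?thesis
  proof (intro exI[of _ m] allI impI)
    fix z :: "'i \<Rightarrow> int" and q :: "'i \<Rightarrow> rat"
    assume q: "\<forall>i\<in>I. 0 \<le> q i"
      and eq: "(\<Sum>i\<in>I. of_int (z i) * a i) = (\<Sum>i\<in>I. of_rat (q i) * a i)"
    define y where "y = (\<Sum>i\<in>I. of_rat (frac (q i)) * a i)"
    have split: "(\<Sum>i\<in>I. of_rat (q i) * a i) = (\<Sum>i\<in>I. of_int \<lfloor>q i\<rfloor> * a i) + y"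
      unfolding y_def by (simp add: frac_def of_rat_diff algebra_simps flip: sum.distrib)
    \<comment> \<open>The remainder is the difference of two integer combinations: the given point
      and its integer part.\<close>
    have "y = (\<Sum>i\<in>I. of_int (z i - \<lfloor>q i\<rfloor>) * a i)"
      using split eq by (simp add: left_diff_distrib sum_subtractf)
    then have "\<exists>z :: 'i \<Rightarrow> int. y = (\<Sum>i\<in>I. of_int (z i) * a i)"
      by (rule exI[of _ "\<lambda>i. z i - \<lfloor>q i\<rfloor>"])
    moreover have "\<forall>i\<in>I. 0 \<le> frac (q i) \<and> frac (q i) < 1"
      by (simp add: frac_lt_1)
    ultimately have y: "y \<in> R"
      unfolding R_def mem_Collect_eq using y_def by (intro conjI exI[of _ "\<lambda>i. frac (q i)"])
    \<comment> \<open>\<open>nat\<close> truncates nothing for \<open>i\<close> in \<open>I\<close>: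
      there \<open>\<lfloor>q i\<rfloor>\<close> is nonnegative and \<open>m\<close> outweighs a
      negative \<open>\<zeta> y i\<close>.\<close>
    define x where "x = (\<lambda>i. nat (int m + \<lfloor>q i\<rfloor> + \<zeta> y i))"
    have x: "of_nat (x i) = (of_nat m + of_int \<lfloor>q i\<rfloor> + of_int (\<zeta> y i) :: real)" if "i \<in> I" for i
    proof -
      have "0 \<le> \<lfloor>q i\<rfloor>" using q that by simp
      with m[OF y that] have "0 \<le> int m + \<lfloor>q i\<rfloor> + \<zeta> y i" by linarith
      then have "int (x i) = int m + \<lfloor>q i\<rfloor> + \<zeta> y i"
        unfolding x_def by (rule nat_0_le)
      then have "of_int (int (x i)) = (of_int (int m + \<lfloor>q i\<rfloor> + \<zeta> y i) :: real)" by simp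
      then show ?thesis by simp
    qed
    have "(\<Sum>i\<in>I. of_nat m * a i) + (\<Sum>i\<in>I. of_rat (q i) * a i) =
        (\<Sum>i\<in>I. of_nat m * a i) + ((\<Sum>i\<in>I. of_int \<lfloor>q i\<rfloor> * a i)
          + (\<Sum>i\<in>I. of_int (\<zeta> y i) * a i))"
      using split \<zeta>[OF y] by simp
    also have "\<dots> = (\<Sum>i\<in>I. of_nat (x i) * a i)"
      by (simp add: x distrib_right sum.distrib)
    finally show "\<exists>x :: 'i \<Rightarrow> nat. (\<Sum>i\<in>I. of_nat m * a i) + (\<Sum>i\<in>I. of_rat (q i) * a i) =
        (\<Sum>i\<in>I. of_nat (x i) * a i)" by blast
  qed
qed

theorem theorem1:
  fixes K :: "real set" and n :: nat and \<alpha> :: "nat \<Rightarrow> real"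
  assumes "real_number_field K"
    and "inj_on \<alpha> {1..n}"
    and "\<And>i. i \<in> {1..n} \<Longrightarrow> \<alpha> i \<in> nonneg_integers K"
    and "\<And>i. i \<in> {1..n} \<Longrightarrow> \<alpha> i \<noteq> 0"
    and "module.span int_scale (\<alpha> ` {1..n}) = ring_of_integers K"
  shows "(\<exists>w \<in> SG n \<alpha>. (\<lambda>v. w + v) ` (CQ n \<alpha> \<inter> ring_of_integers K) \<subseteq> SG n \<alpha>)
       \<and> Frob K n \<alpha> \<noteq> {}"
proof -
  from exists_Frobenius_shift[of "{1..n}" \<alpha>] obtain m :: nat where m:
    "\<And>(z :: nat \<Rightarrow> int) q :: nat \<Rightarrow> rat. \<forall>i\<in>{1..n}. 0 \<le> q i \<Longrightarrow>
      (\<Sum>i=1..n. of_int (z i) * \<alpha> i) = (\<Sum>i=1..n. of_rat (q i) * \<alpha> i) \<Longrightarrow>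
      \<exists>x :: nat \<Rightarrow> nat. (\<Sum>i=1..n. of_nat m * \<alpha> i) + (\<Sum>i=1..n. of_rat (q i) * \<alpha> i) =
        (\<Sum>i=1..n. of_nat (x i) * \<alpha> i)"
    by (meson finite_atLeastAtMost)
  define w where "w = (\<Sum>i=1..n. of_nat m * \<alpha> i)"
  have w: "w \<in> SG n \<alpha>"
    unfolding w_def SG_def by (auto intro!: exI[of _ "\<lambda>_. m"])
  have "w + v \<in> SG n \<alpha>" if vC: "v \<in> CQ n \<alpha>" and vO: "v \<in> ring_of_integers K" for v
  proof -
    from vC obtain q :: "nat \<Rightarrow> rat" where q: "\<forall>i\<in>{1..n}. 0 \<le> q i"
      and v: "v = (\<Sum>i=1..n. of_rat (q i) * \<alpha> i)"
      unfolding CQ_def by blast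
    \<comment> \<open>Since the generators span the ring of integers, \<open>v\<close> also has
      integer coefficients, possibly negative and unrelated to \<open>q\<close>.\<close>
    have "v \<in> {\<Sum>i=1..n. of_int (z i) * \<alpha> i | z. True}"
      using vO assms(5) span_int_scale_image[OF _ assms(2)] by simp
    then obtain z :: "nat \<Rightarrow> int" where z: "v = (\<Sum>i=1..n. of_int (z i) * \<alpha> i)" by blast
    show ?thesis
      using m[OF q z[symmetric, unfolded v]] unfolding w_def v SG_def by blast
  qed
  with w have "\<exists>w \<in> SG n \<alpha>. (\<lambda>v. w + v) ` (CQ n \<alpha> \<inter> ring_of_integers K) \<subseteq> SG n \<alpha>"
    by blast
  then show ?thesis
    unfolding Frob_def by blast
qed

end
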